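(* Let $\varphi:\mathcal{S}^n\to\mathcal{S}^n$ be a self-adjoint positive semidefinite linear operator, $C\in\mathcal{S}^n$, $b\in\mathbb{R}^m$, and let $\mathcal{A}:\mathcal{S}^n\to\mathbb{R}^m$ be a surjective linear map such that there exists a positive definite $\tilde X\in\mathcal{S}^n$ with $\mathcal{A}(\tilde X)=b$. Let $\sigma>0$, and let $\{X^k\}$, $\{y^k\}$, $\{Z^k\}$ be sequences generated by the modified ADMM described in the context (with parameter $\sigma$, from arbitrary $Z^0\in\mathcal{S}^n_+$ and $X^0\in\mathcal{S}^n$). Define, for $k\ge 0$, $$U^{k}:=X^k-\sigma\big(\varphi(X^k)+C-\mathcal{A}^*y^{k+1}\big).$$ Let $K:=\{X\in\mathcal{S}^n\mid \mathcal{A}(X)=b\}$ and $h(X):=\frac12\langle X,\varphi(X)\rangle+\langle C,X\rangle$, and define $\mathcal{T}:\mathcal{S}^n\to\mathcal{S}^n$ by $$\mathcal{T}:=\mathcal{I}-\mathcal{J}_{\sigma\mathcal{N}_{\mathcal{S}^n_+}}+\mathcal{J}_{\sigma\mathcal{N}_{K}}\circ\Big(2\mathcal{J}_{\sigma\mathcal{N}_{\mathcal{S}^n_+}}-\mathcal{I}-\sigma\nabla h\circ\mathcal{J}_{\sigma\mathcal{N}_{\mathcal{S}^n_+}}\Big).$$ Then for all $k\ge 0$, $$U^{k+1}=\mathcal{T}(U^k).$$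
   Context: $\mathcal{S}^n$ is the space of $n\times n$ real symmetric matrices with the trace inner product $\langle\cdot,\cdot\rangle$ and Frobenius norm $\|\cdot\|$; $\mathcal{S}^n_+$ is the cone of positive semidefinite matrices. $\mathcal{A}^*:\mathbb{R}^m\to\mathcal{S}^n$ is the adjoint of $\mathcal{A}$. $\mathcal{I}$ is the identity operator. For a closed convex set $\mathcal{C}$, $\delta_{\mathcal{C}}$ is its indicator function ($0$ on $\mathcal C$, $+\infty$ elsewhere), $\mathcal{N}_{\mathcal{C}}=\partial\delta_{\mathcal{C}}$ is its normal cone mapping. For a maximal monotone operator $\mathcal{F}$ and $\sigma>0$, $\mathcal{J}_{\sigma\mathcal{F}}:=(\mathcal{I}+\sigma\mathcal{F})^{-1}$ is its (single-valued) resolvent; in particular $\mathcal{J}_{\sigma\mathcal{N}_{\mathcal{C}}}=\Pi_{\mathcal{C}}$, the metric projection onto $\mathcal{C}$. Here $\nabla h(X)=\varphi(X)+C$. The underlying problem is the convex quadratic semidefinite program $\min\{\frac12\langle X,\varphi(X)\rangle+\langle C,X\rangle : \mathcal{A}(X)=b,\ X\in\mathcal{S}^n_+\}$, with dual (in minimization form) $\min_{W,y,Z}\{\frac12\langle W,\varphi(W)\rangle-b^Ty+\delta_{\mathcal{S}^n_+}(Z) : -\varphi(W)+\mathcal{A}^*(y)+Z=C\}$. For $\sigma>0$ the augmented Lagrangian of the dual is $$\mathcal{L}_\sigma(W,y,Z;X):=\tfrac12\langle W,\varphi(W)\rangle-b^Ty+\delta_{\mathcal{S}^n_+}(Z)+\langle-\varphi(W)+\mathcal{A}^*(y)+Z-C,X\rangle+\tfrac{\sigma}{2}\|-\varphi(W)+\mathcal{A}^*(y)+Z-C\|^2.$$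 Modified ADMM: given $\sigma>0$, $Z^0\in\mathcal{S}^n_+$, $X^0\in\mathcal{S}^n$, for $k=0,1,\ldots$: Step 1: $W^{k+1}:=X^k$; Step 2: $y^{k+1}:=\operatorname{argmin}_{y\in\mathbb{R}^m}\mathcal{L}_\sigma(W^{k+1},y,Z^k;X^k)$; Step 3: $Z^{k+1}:=\operatorname{argmin}_{Z\in\mathcal{S}^n}\mathcal{L}_\sigma(W^{k+1},y^{k+1},Z;X^k)$; Step 4: $X^{k+1}:=X^k+\sigma\big(\mathcal{A}^*(y^{k+1})+Z^{k+1}-\varphi(W^{k+1})-C\big)$. *)

theory Defs
  imports "HOL-Analysis.Analysis"
begin

typedef ('n::finite) symmat = "{M :: real^'n^'n. transpose M = M}"
  morphisms mat_of Symmat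
  by (rule exI[of _ 0]) (simp add: transpose_def vec_eq_iff)

lemma transpose_mat_of [simp]: "transpose (mat_of X) = mat_of X"
  using mat_of[of X] by simp

lemma mat_of_Symmat: "transpose M = M \<Longrightarrow> mat_of (Symmat M) = M"
  by (simp add: Symmat_inverse)

lemma inner_matrix_eq_trace: "inner (M :: real^'n^'m) N = trace (transpose M ** N)"
proof -
  have "inner M N = (\<Sum>i\<in>UNIV. \<Sum>j\<in>UNIV. M $ i $ j * N $ i $ j)"
    by (simp add: inner_vec_def)
  also have "\<dots> = (\<Sum>j\<in>UNIV. \<Sum>i\<in>UNIV. M $ i $ j * N $ i $ j)"
    by (rule sum.swap)
  finally show ?thesis
    by (simp add: trace_def matrix_matrix_mult_def transpose_def)
qed

instantiation symmat :: (finite) real_inner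
begin

definition "(0 :: 'a symmat) = Symmat 0"
definition "X + Y = Symmat (mat_of X + mat_of Y)"
definition "X - Y = Symmat (mat_of X - mat_of Y)"
definition "- X = Symmat (- mat_of X)"
definition "r *\<^sub>R (X :: 'a symmat) = Symmat (r *\<^sub>R mat_of X)"
definition "inner X Y = trace (mat_of X ** mat_of Y)"
definition "norm (X :: 'a symmat) = sqrt (inner X X)"
definition "sgn (X :: 'a symmat) = inverse (norm X) *\<^sub>R X"
definition "dist (X :: 'a symmat) Y = norm (X - Y)"
definition "(uniformity :: ('a symmat \<times> 'a symmat) filter) =
  (INF e\<in>{0<..}. principal {(X, Y). dist X Y < e})"
definition "open (S :: 'a symmat set) =
  (\<forall>X\<in>S. \<forall>\<^sub>F (X', Y) in uniformity. X' = X \<longrightarrow> Y \<in> S)"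

lemma mat_of_zero [simp]: "mat_of 0 = 0"
  unfolding zero_symmat_def
  by (rule mat_of_Symmat) (simp add: transpose_def vec_eq_iff)

lemma mat_of_add [simp]: "mat_of (X + Y) = mat_of X + mat_of Y"
  unfolding plus_symmat_def
  using transpose_mat_of[of X] transpose_mat_of[of Y]
  by (intro mat_of_Symmat) (simp add: transpose_def vec_eq_iff)

lemma mat_of_diff [simp]: "mat_of (X - Y) = mat_of X - mat_of Y"
  unfolding minus_symmat_def
  using transpose_mat_of[of X] transpose_mat_of[of Y]
  by (intro mat_of_Symmat) (simp add: transpose_def vec_eq_iff)

lemma mat_of_uminus [simp]: "mat_of (- X) = - mat_of X"
  unfolding uminus_symmat_def
  using transpose_mat_of[of X]
  by (intro mat_of_Symmat) (simp add: transpose_def vec_eq_iff)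

lemma mat_of_scaleR [simp]: "mat_of (r *\<^sub>R X) = r *\<^sub>R mat_of X"
  unfolding scaleR_symmat_def
  using transpose_mat_of[of X]
  by (intro mat_of_Symmat) (simp add: transpose_def vec_eq_iff)

lemma inner_mat_of: "inner X Y = inner (mat_of X) (mat_of Y)"
  by (simp add: inner_symmat_def inner_matrix_eq_trace)

instance
proof
  fix X Y Z :: "'a symmat" and r s :: real and S :: "'a symmat set"
  show "X + Y + Z = X + (Y + Z)" "X + Y = Y + X" "0 + X = X" "- X + X = 0" "X - Y = X + - Y"
    "r *\<^sub>R (X + Y) = r *\<^sub>R X + r *\<^sub>R Y" "(r + s) *\<^sub>R X = r *\<^sub>R X + s *\<^sub>R X"
    "r *\<^sub>R s *\<^sub>R X = (r * s) *\<^sub>R X" "1 *\<^sub>R X = X"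
    by (simp_all add: mat_of_inject[symmetric] algebra_simps)
  show "dist X Y = norm (X - Y)" by (rule dist_symmat_def)
  show "sgn X = inverse (norm X) *\<^sub>R X" by (rule sgn_symmat_def)
  show "(uniformity :: ('a symmat \<times> 'a symmat) filter) =
      (INF e\<in>{0<..}. principal {(X, Y). dist X Y < e})"
    by (rule uniformity_symmat_def)
  show "open S = (\<forall>X\<in>S. \<forall>\<^sub>F (X', Y) in uniformity. X' = X \<longrightarrow> Y \<in> S)"
    by (rule open_symmat_def)
  show "inner X Y = inner Y X" "inner (X + Y) Z = inner X Z + inner Y Z"
    "inner (r *\<^sub>R X) Y = r * inner X Y" "0 \<le> inner X X"
    by (simp_all add: inner_mat_of inner_add_left inner_commute[of "mat_of X" "mat_of Y"])
  show "(inner X X = 0) = (X = 0)"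
    by (simp add: inner_mat_of mat_of_inject[symmetric])
  show "norm X = sqrt (inner X X)" by (rule norm_symmat_def)
qed

end

lemma ex_symmat_basis:
  "\<exists>B :: ('n::finite) symmat set. finite B \<and> B \<noteq> {} \<and>
     (\<forall>U\<in>B. \<forall>V\<in>B. inner U V = (if U = V then 1 else 0)) \<and>
     (\<forall>X. (\<forall>U\<in>B. inner X U = 0) \<longleftrightarrow> X = 0)"
proof -
  let ?S = "range (mat_of :: 'n symmat \<Rightarrow> real^'n^'n)"
  have S: "?S = {M. transpose M = M}"
    using type_definition.Rep_range[OF type_definition_symmat] .
  have sub: "subspace ?S"
    unfolding S by (simp add: subspace_def transpose_def vec_eq_iff)
  obtain B where B: "B \<subseteq> ?S" "pairwise orthogonal B" "\<And>x. x \<in> B \<Longrightarrow> norm x = 1"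
      "independent B" "span B = ?S"
    using orthonormal_basis_subspace[OF sub] by metis
  let ?B = "mat_of -` B :: 'n symmat set"
  have fin: "finite ?B"
    using independent_imp_finite[OF B(4)] by (rule finite_vimageI) (simp add: inj_def mat_of_inject)
  have imB: "mat_of ` ?B = B" using B(1) by auto
  have orth: "inner U V = (if U = V then 1 else 0)" if "U \<in> ?B" "V \<in> ?B" for U V
  proof (cases "U = V")
    case True
    have "norm (mat_of U) = 1" using that B(3) by auto
    then show ?thesis using True by (simp add: inner_mat_of dot_square_norm)
  next
    case False
    then have "mat_of U \<noteq> mat_of V" by (simp add: mat_of_inject)
    then show ?thesis using that B(2) False
      by (auto simp: pairwise_def orthogonal_def inner_mat_of)
  qed
  have zero: "X = 0" if "\<forall>U\<in>?B. inner X U = 0" for X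
  proof -
    have "orthogonal (mat_of X) v" if v: "v \<in> B" for v
    proof -
      obtain V where "v = mat_of V" using v B(1) by auto
      then show ?thesis using \<open>\<forall>U\<in>?B. inner X U = 0\<close> v
        by (simp add: orthogonal_def inner_mat_of)
    qed
    then have "orthogonal (mat_of X) (mat_of X)"
      using orthogonal_to_span[of "mat_of X" B "mat_of X"] B(5) by auto
    then show ?thesis by (simp add: orthogonal_self mat_of_inject[symmetric])
  qed
  have "?B \<noteq> {}"
  proof
    assume "?B = {}"
    then have "Symmat (mat 1 :: real^'n^'n) = 0" using zero by blast
    then have "mat 1 = (0 :: real^'n^'n)"
      by (metis mat_of_Symmat mat_of_zero transpose_mat)
    then have "(mat 1 :: real^'n^'n) $ i $ i = 0" for i by simp
    then show False by (simp add: mat_def)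
  qed
  moreover have "(\<forall>U\<in>?B. inner X U = 0) \<longleftrightarrow> X = 0" for X
    using zero[of X] by (metis inner_zero_left)
  ultimately show ?thesis
    using fin orth by (intro exI[of _ ?B] conjI ballI allI) assumption+
qed

instantiation symmat :: (finite) euclidean_space
begin

definition "Basis = (SOME B :: 'a symmat set. finite B \<and> B \<noteq> {} \<and>
     (\<forall>U\<in>B. \<forall>V\<in>B. inner U V = (if U = V then 1 else 0)) \<and>
     (\<forall>X. (\<forall>U\<in>B. inner X U = 0) \<longleftrightarrow> X = 0))"

instance
proof
  have basis: "finite (Basis :: 'a symmat set)" "(Basis :: 'a symmat set) \<noteq> {}"
    "\<forall>U\<in>Basis. \<forall>V\<in>(Basis :: 'a symmat set). inner U V = (if U = V then 1 else 0)"
    "\<forall>X :: 'a symmat. (\<forall>U\<in>Basis. inner X U = 0) \<longleftrightarrow> X = 0"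
    using someI_ex[OF ex_symmat_basis[where 'n = 'a]] unfolding Basis_symmat_def by blast+
  show "(Basis :: 'a symmat set) \<noteq> {}" "finite (Basis :: 'a symmat set)"
    using basis(1,2) by simp_all
  show "inner U V = (if U = V then 1 else 0)" if "U \<in> Basis" "V \<in> Basis" for U V :: "'a symmat"
    using basis(3) that by simp
  show "(\<forall>U\<in>Basis. inner X U = 0) \<longleftrightarrow> X = 0" for X :: "'a symmat"
    using basis(4) by simp
qed

end

definition psd_cone :: "('n::finite) symmat set" where
  "psd_cone = {X. \<forall>v. 0 \<le> inner v (mat_of X *v v)}"

definition pos_def :: "('n::finite) symmat \<Rightarrow> bool" where
  "pos_def X \<longleftrightarrow> (\<forall>v. v \<noteq> 0 \<longrightarrow> 0 < inner v (mat_of X *v v))"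

definition indicator_fn :: "'a set \<Rightarrow> 'a \<Rightarrow> ereal" where
  "indicator_fn C x = (if x \<in> C then 0 else \<infinity>)"

definition subdifferential :: "('a::real_inner \<Rightarrow> ereal) \<Rightarrow> 'a \<Rightarrow> 'a set" where
  "subdifferential f x = {v. \<forall>y. f x + ereal (inner v (y - x)) \<le> f y}"

definition normal_cone :: "('a::real_inner) set \<Rightarrow> 'a \<Rightarrow> 'a set" where
  "normal_cone C = subdifferential (indicator_fn C)"

text \<open>A set-valued operator is a function into sets; the resolvent
  \<open>(I + \<sigma> F)\<inverse>\<close> maps \<open>x\<close> to the unique \<open>p\<close> with \<open>x \<in> p + \<sigma> F p\<close>,
  and is meaningful for maximal monotone \<open>F\<close> and \<open>\<sigma> > 0\<close>.\<close>

definition resolvent :: "real \<Rightarrow> ('a::real_inner \<Rightarrow> 'a set) \<Rightarrow> 'a \<Rightarrow> 'a" where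
  "resolvent \<sigma> F x = (THE p. x \<in> (\<lambda>v. p + \<sigma> *\<^sub>R v) ` F p)"

definition gradient :: "('a::real_inner \<Rightarrow> real) \<Rightarrow> 'a \<Rightarrow> 'a" where
  "gradient f x = (THE D. GDERIV f x :> D)"

definition aug_lagrangian ::
  "(('n::finite) symmat \<Rightarrow> 'n symmat) \<Rightarrow> ('n symmat \<Rightarrow> real^'m) \<Rightarrow> 'n symmat \<Rightarrow> real^'m \<Rightarrow> real \<Rightarrow>
   'n symmat \<Rightarrow> real^'m \<Rightarrow> 'n symmat \<Rightarrow> 'n symmat \<Rightarrow> ereal" where
  "aug_lagrangian \<phi> \<A> C b \<sigma> W y Z X =
     ereal (1/2 * inner W (\<phi> W) - inner b y) + indicator_fn psd_cone Z
     + ereal (inner (- \<phi> W + adjoint \<A> y + Z - C) X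
              + \<sigma> / 2 * (norm (- \<phi> W + adjoint \<A> y + Z - C))\<^sup>2)"

text \<open>The values \<open>W 0\<close> and \<open>y 0\<close> are not used by the iteration and remain unconstrained.\<close>

definition modified_admm ::
  "(('n::finite) symmat \<Rightarrow> 'n symmat) \<Rightarrow> ('n symmat \<Rightarrow> real^'m) \<Rightarrow> 'n symmat \<Rightarrow> real^'m \<Rightarrow> real \<Rightarrow>
   (nat \<Rightarrow> 'n symmat) \<Rightarrow> (nat \<Rightarrow> real^'m) \<Rightarrow> (nat \<Rightarrow> 'n symmat) \<Rightarrow> (nat \<Rightarrow> 'n symmat) \<Rightarrow> bool" where
  "modified_admm \<phi> \<A> C b \<sigma> W y Z X \<longleftrightarrow>
     Z 0 \<in> psd_cone \<and>
     (\<forall>k. W (Suc k) = X k \<and>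
        is_arg_min (\<lambda>y'. aug_lagrangian \<phi> \<A> C b \<sigma> (W (Suc k)) y' (Z k) (X k))
          (\<lambda>_. True) (y (Suc k)) \<and>
        is_arg_min (\<lambda>Z'. aug_lagrangian \<phi> \<A> C b \<sigma> (W (Suc k)) (y (Suc k)) Z' (X k))
          (\<lambda>_. True) (Z (Suc k)) \<and>
        X (Suc k) = X k + \<sigma> *\<^sub>R (adjoint \<A> (y (Suc k)) + Z (Suc k) - \<phi> (W (Suc k)) - C))"

end

theory Submission
  imports Defs
begin

text \<open>The optimality condition of the \<open>Z\<close>-step says that \<open>X (k+1)\<close> and \<open>Z (k+1)\<close> are positive
  semidefinite and orthogonal, so \<open>U k = X (k+1) - \<sigma> Z (k+1)\<close> is the Moreau decomposition of \<open>U k\<close>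
  and \<open>X (k+1)\<close> is the projection of \<open>U k\<close> onto the cone. The next \<open>y\<close>-step is stationary exactly
  when the argument of the second resolvent, shifted by \<open>\<sigma> \<A>\<^sup>* y (k+2)\<close>, lies in \<open>K\<close>; since the
  range of \<open>\<A>\<^sup>*\<close> is orthogonal to the kernel of \<open>\<A>\<close>, this point is the projection onto \<open>K\<close>.\<close>

section \<open>Resolvents of normal cones, gradients and one-sided slopes\<close>

text \<open>The variational inequality is membership of \<open>x - p\<close> in the normal cone at
  \<open>p\<close>, which absorbs the factor \<open>\<sigma>\<close>. Monotonicity then gives the
  uniqueness demanded by \<open>THE\<close>.\<close>

lemma resolvent_normal_cone_eqI:
  assumes "\<sigma> > 0" and p: "p \<in> S" and var: "\<And>q. q \<in> S \<Longrightarrow> inner (x - p) (q - p) \<le> 0"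
  shows "resolvent \<sigma> (normal_cone S) x = p"
  unfolding resolvent_def
proof (rule the_equality)
  have "inner (inverse \<sigma> *\<^sub>R (x - p)) (q - p) \<le> 0" if "q \<in> S" for q
    using var[OF that] \<open>\<sigma> > 0\<close> by (simp add: mult_nonneg_nonpos)
  then have "inverse \<sigma> *\<^sub>R (x - p) \<in> normal_cone S p"
    using p by (auto simp: normal_cone_def subdifferential_def indicator_fn_def zero_ereal_def)
  moreover have "x = p + \<sigma> *\<^sub>R (inverse \<sigma> *\<^sub>R (x - p))"
    using \<open>\<sigma> > 0\<close> by simp
  ultimately show "x \<in> (\<lambda>v. p + \<sigma> *\<^sub>R v) ` normal_cone S p"
    by blast
next
  fix r assume "x \<in> (\<lambda>v. r + \<sigma> *\<^sub>R v) ` normal_cone S r"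
  then obtain v where x: "x = r + \<sigma> *\<^sub>R v" and v: "v \<in> normal_cone S r" by blast
  have sub: "indicator_fn S r + ereal (inner v (q - r)) \<le> indicator_fn S q" for q
    using v by (simp add: normal_cone_def subdifferential_def)
  \<comment> \<open>Outside \<open>S\<close> the subgradient inequality, tested at \<open>p\<close>,
    would read \<infinity> \<le> 0.\<close>
  have r: "r \<in> S"
    using sub[of p] p by (auto simp: indicator_fn_def split: if_splits)
  have "inner v (p - r) \<le> 0"
    using sub[of p] p r by (simp add: indicator_fn_def zero_ereal_def)
  then have "inner (x - r) (p - r) \<le> 0"
    using \<open>\<sigma> > 0\<close> by (simp add: x mult_nonneg_nonpos)
  with var[OF r] have "inner (r - p) (r - p) \<le> 0"
    by (simp add: inner_diff_left inner_diff_right inner_commute)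
  then show "r = p"
    by (metis inner_ge_zero inner_eq_zero_iff order_antisym eq_iff_diff_eq_0)
qed

lemma gradient_eqI:
  assumes "GDERIV f x :> D"
  shows "gradient f x = D"
  unfolding gradient_def
proof (rule the_equality[where P = "\<lambda>D. GDERIV f x :> D", OF assms])
  fix E assume "GDERIV f x :> E"
  then have "(\<lambda>v. inner v E) = (\<lambda>v. inner v D)"
    using assms unfolding gderiv_def by (rule has_derivative_unique)
  then have "inner (E - D) E = inner (E - D) D" by metis
  then show "E = D"
    by (metis inner_diff_right inner_eq_zero_iff right_minus_eq)
qed

lemma gradient_quadratic:
  fixes \<phi> :: "'a::euclidean_space \<Rightarrow> 'a"
  assumes "linear \<phi>" and sa: "\<And>P Q. inner (\<phi> P) Q = inner P (\<phi> Q)"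
  shows "gradient (\<lambda>P. 1/2 * inner P (\<phi> P) + inner C P) P = \<phi> P + C"
proof (rule gradient_eqI)
  have "bounded_linear \<phi>" using \<open>linear \<phi>\<close> by (rule linear_conv_bounded_linear[THEN iffD1])
  then have d: "(\<phi> has_derivative \<phi>) (at P)"
    by (rule bounded_linear_imp_has_derivative)
  have "((\<lambda>P. 1/2 * inner P (\<phi> P) + inner C P) has_derivative
      (\<lambda>v. 1/2 * (inner P (\<phi> v) + inner v (\<phi> P)) + inner C v)) (at P)"
    by (auto intro!: derivative_eq_intros d)
  \<comment> \<open>Self-adjointness makes the two halves of the derivative equal, so they add up to
    \<open>\<phi> P\<close>.\<close>
  moreover have "1/2 * (inner P (\<phi> v) + inner v (\<phi> P)) + inner C v = inner v (\<phi> P + C)" for v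
    by (simp add: sa[symmetric, of P v] inner_add_right inner_commute[of _ v])
  ultimately show "GDERIV (\<lambda>P. 1/2 * inner P (\<phi> P) + inner C P) P :> \<phi> P + C"
    by (simp add: gderiv_def)
qed

text \<open>Divide by \<open>t\<close> and let \<open>t\<close> tend to 0 from the right. Only
  \<open>t\<close> up to 1 is tested, so that steps along a segment inside a convex set
  suffice.\<close>

lemma slope_nonneg:
  fixes a c :: real
  assumes "\<And>t. 0 < t \<Longrightarrow> t \<le> 1 \<Longrightarrow> 0 \<le> t * a + t\<^sup>2 * c"
  shows "0 \<le> a"
proof -
  have "((\<lambda>t. a + t * c) \<longlongrightarrow> a + 0 * c) (at_right 0)"
    by (intro tendsto_intros)
  moreover have "\<forall>\<^sub>F t in at_right 0. 0 \<le> a + t * c"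
  proof (rule eventually_at_rightI[of 0 1])
    fix t :: real assume t: "t \<in> {0<..<1}"
    then have "0 \<le> t * (a + t * c)"
      using assms[of t] by (simp add: power2_eq_square algebra_simps)
    then show "0 \<le> a + t * c" using t by (simp add: zero_le_mult_iff)
  qed simp
  ultimately have "0 \<le> a + 0 * c"
    by (rule tendsto_lowerbound) simp
  then show ?thesis by simp
qed

section \<open>Self-duality of the positive semidefinite cone\<close>

text \<open>The rank-one matrix w w^T.\<close>

definition outer :: "real^'n \<Rightarrow> real^'n^'n" where
  "outer w = (\<chi> i j. w $ i * w $ j)"

lemma transpose_outer: "transpose (outer w) = outer w"
  by (simp add: outer_def transpose_def vec_eq_iff)

lemma outer_mult_vec: "outer w *v u = inner w u *\<^sub>R w"
  by (simp add: outer_def matrix_vector_mult_def vec_eq_iff inner_vec_def sum_distrib_left mult_ac)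

lemma inner_outer: "inner M (outer w) = inner w (M *v w)"
  by (simp add: outer_def matrix_vector_mult_def inner_vec_def sum_distrib_left mult_ac)

lemma symmetric_inner:
  fixes M :: "real^'n^'n"
  assumes "transpose M = M"
  shows "inner u (M *v v) = inner v (M *v u)"
  using dot_lmul_matrix[of u M v] vector_transpose_matrix[of u M]
  by (simp add: assms inner_commute)

lemma psd_Cauchy_Schwarz:
  fixes M :: "real^'n^'n"
  assumes sym: "transpose M = M" and psd: "\<And>v. 0 \<le> inner v (M *v v)"
  shows "(inner u (M *v v))\<^sup>2 \<le> inner u (M *v u) * inner v (M *v v)"
proof -
  define a b c where "a = inner v (M *v v)" "b = inner u (M *v u)" "c = inner u (M *v v)"
  have quad: "0 \<le> s\<^sup>2 * b - 2 * s * t * c + t\<^sup>2 * a" for s t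
  proof -
    have "inner (s *\<^sub>R u - t *\<^sub>R v) (M *v (s *\<^sub>R u - t *\<^sub>R v)) = s\<^sup>2 * b - 2 * s * t * c + t\<^sup>2 * a"
      using symmetric_inner[OF sym, of v u]
      by (simp add: a_b_c_def matrix_vector_mult_diff_distrib matrix_vector_mult_scaleR
          inner_diff_left inner_diff_right power2_eq_square algebra_simps)
    then show ?thesis using psd[of "s *\<^sub>R u - t *\<^sub>R v"] by simp
  qed
  have "0 \<le> a" using psd by (simp add: a_b_c_def)
  then consider "a = 0" | "a > 0" by linarith
  then have "c\<^sup>2 \<le> b * a"
  proof cases
    case 1
    \<comment> \<open>For \<open>a = 0\<close> and \<open>s = 1\<close> the form is
      \<open>b - 2 * t * c\<close>; the chosen \<open>t\<close> would make it -1.\<close>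
    have "c = 0"
      using quad[of 1 "(b + 1) / (2 * c)"] 1 by (cases "c = 0") (auto simp: field_simps)
    then show ?thesis using 1 by simp
  next
    case 2
    \<comment> \<open>Up to scale, \<open>s = a\<close> and \<open>t = c\<close> minimise the
      form.\<close>
    have "0 \<le> a * (b * a - c\<^sup>2)"
      using quad[of a c] by (simp add: power2_eq_square algebra_simps)
    then show ?thesis using 2 by (simp add: zero_le_mult_iff)
  qed
  then show ?thesis by (simp add: a_b_c_def)
qed

text \<open>Induction on the rank replaces the spectral theorem: subtracting \<open>outer (M v) / (v \<bullet> M v)\<close>
  keeps \<open>M\<close> positive semidefinite (by Cauchy-Schwarz) and adds \<open>v\<close> to its kernel.\<close>

lemma inner_psd_nonneg:
  fixes M N :: "real^'n^'n"
  assumes "transpose M = M" "\<And>v. 0 \<le> inner v (M *v v)" and N: "\<And>v. 0 \<le> inner v (N *v v)"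
  shows "0 \<le> inner N M"
  using assms(1,2)
proof (induction "CARD('n) - dim {v. M *v v = 0}" arbitrary: M rule: less_induct)
  case less
  note sym = less.prems(1) and psd = less.prems(2)
  show ?case
  proof (cases "M = 0")
    case True
    then show ?thesis by simp
  next
    case False
    then obtain v where v: "M *v v \<noteq> 0"
      by (metis matrix_eq matrix_vector_mult_0)
    define a where "a = inner v (M *v v)"
    have "a \<noteq> 0"
    proof
      assume "a = 0"
      \<comment> \<open>Cauchy-Schwarz against \<open>M *v v\<close> bounds the square of this
        number by a multiple of \<open>a\<close>.\<close>
      then have "inner (M *v v) (M *v v) = 0"
        using psd_Cauchy_Schwarz[OF sym psd, of "M *v v" v] by (simp add: a_def)
      with v show False by simp
    qed
    with psd[of v] have a: "a > 0" by (simp add: a_def)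
    define M' where "M' = M - inverse a *\<^sub>R outer (M *v v)"
    have M'_mult: "M' *v u = M *v u - (inner (M *v v) u / a) *\<^sub>R (M *v v)" for u
      by (simp add: M'_def matrix_vector_mult_diff_rdistrib scaleR_matrix_vector_assoc[symmetric]
          outer_mult_vec field_simps)
    have sym': "transpose M' = M'"
      using sym transpose_outer[of "M *v v"]
      by (simp add: M'_def transpose_def vec_eq_iff)
    have psd': "0 \<le> inner u (M' *v u)" for u
    proof -
      have "inner u (M' *v u) = inner u (M *v u) - (inner u (M *v v))\<^sup>2 / a"
        by (simp add: M'_mult inner_diff_right power2_eq_square inner_commute)
      moreover have "(inner u (M *v v))\<^sup>2 \<le> inner u (M *v u) * a"
        unfolding a_def by (rule psd_Cauchy_Schwarz[OF sym psd])
      ultimately show ?thesis using a by (simp add: divide_le_eq)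
    qed
    have ker: "M' *v u = 0" if "M *v u = 0" for u
      using symmetric_inner[OF sym, of v u] that by (simp add: M'_mult inner_commute)
    have "M' *v v = 0"
      using a by (simp add: M'_mult a_def inner_commute)
    with ker v have sub: "{u. M *v u = 0} \<subset> {u. M' *v u = 0}" by auto
    have subsp: "subspace {u. B *v u = 0}" for B :: "real^'n^'n"
      by (rule linear_subspace_kernel) simp
    have "dim {u. M *v u = 0} < dim {u. M' *v u = 0}"
      using sub subsp by (intro dim_psubset) (simp only: span_eq_iff[THEN iffD2, OF subsp])
    moreover have "dim {u. M' *v u = 0} \<le> CARD('n)"
      by (rule dim_subset_UNIV_cart)
    ultimately have "0 \<le> inner N M'"
      by (intro less.hyps sym' psd') linarith
    \<comment> \<open>Pairing \<open>N\<close> with the removed rank-one term evaluates the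
      quadratic form of \<open>N\<close> at \<open>M *v v\<close>.\<close>
    moreover have "inner N M = inner N M' + inverse a * inner (M *v v) (N *v (M *v v))"
      by (simp add: M'_def inner_diff_right inner_outer)
    ultimately show ?thesis using a N[of "M *v v"] by simp
  qed
qed

lemma inner_psd_cone_nonneg:
  assumes "P \<in> psd_cone" "Q \<in> psd_cone"
  shows "0 \<le> inner P Q"
  using assms inner_psd_nonneg[of "mat_of Q" "mat_of P"]
  by (simp add: inner_mat_of psd_cone_def)

text \<open>Testing against the matrices \<open>outer w\<close> recovers the quadratic form of
  \<open>P\<close>. This is what turns the optimality of the \<open>Z\<close>-step into
  semidefiniteness of the new \<open>X\<close>.\<close>

lemma psd_cone_iff_dual: "P \<in> psd_cone \<longleftrightarrow> (\<forall>Q\<in>psd_cone. 0 \<le> inner P Q)"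
proof (intro iffI ballI)
  assume P: "\<forall>Q\<in>psd_cone. 0 \<le> inner P Q"
  have "0 \<le> inner w (mat_of P *v w)" for w
  proof -
    have [simp]: "mat_of (Symmat (outer w)) = outer w"
      by (simp add: mat_of_Symmat transpose_outer)
    have "Symmat (outer w) \<in> psd_cone"
      by (simp add: psd_cone_def outer_mult_vec inner_commute[of w])
    with P have "0 \<le> inner P (Symmat (outer w))" by blast
    then show ?thesis by (simp add: inner_mat_of inner_outer)
  qed
  then show "P \<in> psd_cone" by (simp add: psd_cone_def)
qed (rule inner_psd_cone_nonneg)

lemma zero_in_psd_cone: "0 \<in> psd_cone"
  by (simp add: psd_cone_def)

lemma psd_cone_add: "P \<in> psd_cone \<Longrightarrow> Q \<in> psd_cone \<Longrightarrow> P + Q \<in> psd_cone"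
  by (simp add: psd_cone_def matrix_vector_mult_add_rdistrib inner_add_right)

lemma psd_cone_scaleR: "P \<in> psd_cone \<Longrightarrow> 0 \<le> t \<Longrightarrow> t *\<^sub>R P \<in> psd_cone"
  by (simp add: psd_cone_def scaleR_matrix_vector_assoc[symmetric])

section \<open>Optimality conditions of the two minimisation steps\<close>

text \<open>Off the cone the objective is infinite, while at 0 it is finite.\<close>

lemma argmin_psd_in_cone:
  assumes "is_arg_min (\<lambda>Z. aug_lagrangian \<phi> \<A> C b \<sigma> W y Z X) (\<lambda>_. True) Z"
  shows "Z \<in> psd_cone"
proof (rule ccontr)
  assume "Z \<notin> psd_cone"
  then have "aug_lagrangian \<phi> \<A> C b \<sigma> W y 0 X < aug_lagrangian \<phi> \<A> C b \<sigma> W y Z X"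
    by (simp add: aug_lagrangian_def indicator_fn_def zero_in_psd_cone)
  with assms show False by (simp add: is_arg_min_def)
qed

lemma aug_lagrangian_psd:
  assumes "Z \<in> psd_cone"
  shows "aug_lagrangian \<phi> \<A> C b \<sigma> W y Z X =
    ereal (1/2 * inner W (\<phi> W) - inner b y + inner (- \<phi> W + adjoint \<A> y + Z - C) X
      + \<sigma> / 2 * (norm (- \<phi> W + adjoint \<A> y + Z - C))\<^sup>2)"
  using assms by (simp add: aug_lagrangian_def indicator_fn_def)

lemma power2_norm_add_scaleR:
  fixes u v :: "'a::real_inner"
  shows "(norm (u + t *\<^sub>R v))\<^sup>2 = (norm u)\<^sup>2 + 2 * t * inner u v + t\<^sup>2 * (norm v)\<^sup>2"
  unfolding power2_norm_eq_inner
  by (simp add: inner_add_left inner_add_right inner_commute[of v u] power2_eq_square algebra_simps)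

text \<open>The vector paired with \<open>Q - Z\<close> is the gradient in \<open>Z\<close> of the
  smooth part of the objective. In the iteration it coincides with the multiplier update.\<close>

lemma argmin_psd_variational:
  assumes argmin: "is_arg_min (\<lambda>Z. aug_lagrangian \<phi> \<A> C b \<sigma> W y Z X) (\<lambda>_. True) Z"
    and Q: "Q \<in> psd_cone"
  shows "0 \<le> inner (X + \<sigma> *\<^sub>R (- \<phi> W + adjoint \<A> y + Z - C)) (Q - Z)"
proof (rule slope_nonneg)
  fix t :: real assume t: "0 < t" "t \<le> 1"
  have Z: "Z \<in> psd_cone" using argmin by (rule argmin_psd_in_cone)
  define E where "E = - \<phi> W + adjoint \<A> y + Z - C"
  have "Z + t *\<^sub>R (Q - Z) = (1 - t) *\<^sub>R Z + t *\<^sub>R Q"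
    by (simp add: algebra_simps)
  then have Zt: "Z + t *\<^sub>R (Q - Z) \<in> psd_cone"
    using t Z Q by (simp add: psd_cone_add psd_cone_scaleR)
  have Et: "- \<phi> W + adjoint \<A> y + (Z + t *\<^sub>R (Q - Z)) - C = E + t *\<^sub>R (Q - Z)"
    by (simp add: E_def)
  have "aug_lagrangian \<phi> \<A> C b \<sigma> W y Z X \<le> aug_lagrangian \<phi> \<A> C b \<sigma> W y (Z + t *\<^sub>R (Q - Z)) X"
    using argmin by (simp add: is_arg_min_def not_less)
  then have "inner E X + \<sigma> / 2 * (norm E)\<^sup>2
      \<le> inner (E + t *\<^sub>R (Q - Z)) X + \<sigma> / 2 * (norm (E + t *\<^sub>R (Q - Z)))\<^sup>2"
    unfolding aug_lagrangian_psd[OF Z] aug_lagrangian_psd[OF Zt] Et E_def[symmetric] by simp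
  then show "0 \<le> t * inner (X + \<sigma> *\<^sub>R (- \<phi> W + adjoint \<A> y + Z - C)) (Q - Z)
      + t\<^sup>2 * (\<sigma> / 2 * (norm (Q - Z))\<^sup>2)"
    unfolding E_def[symmetric] power2_norm_add_scaleR
    by (simp add: inner_add_left inner_commute[of X Q] inner_commute[of X Z] algebra_simps)
qed

text \<open>As \<open>y\<close> is unconstrained, the slope is nonnegative in every direction, in
  particular against the gradient, which must therefore vanish.\<close>

lemma argmin_multiplier_stationary:
  fixes \<A> :: "('n::finite) symmat \<Rightarrow> real^'m"
  assumes argmin: "is_arg_min (\<lambda>y. aug_lagrangian \<phi> \<A> C b \<sigma> W y Z X) (\<lambda>_. True) y"
    and Z: "Z \<in> psd_cone" and lin: "linear \<A>"
  shows "\<A> (X + \<sigma> *\<^sub>R (- \<phi> W + adjoint \<A> y + Z - C)) = b"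
proof -
  define E where "E = - \<phi> W + adjoint \<A> y + Z - C"
  have adj: "inner P (adjoint \<A> d) = inner (\<A> P) d" for P d
    using adjoint_works[OF lin] .
  have linadj: "linear (adjoint \<A>)" using lin by (rule adjoint_linear)
  have slope: "0 \<le> inner (\<A> (X + \<sigma> *\<^sub>R E) - b) d" for d
  proof (rule slope_nonneg)
    fix t :: real assume "0 < t"
    have Et: "- \<phi> W + adjoint \<A> (y + t *\<^sub>R d) + Z - C = E + t *\<^sub>R adjoint \<A> d"
      by (simp add: E_def linear_add[OF linadj] linear_scale[OF linadj])
    have "aug_lagrangian \<phi> \<A> C b \<sigma> W y Z X \<le> aug_lagrangian \<phi> \<A> C b \<sigma> W (y + t *\<^sub>R d) Z X"
      using argmin by (simp add: is_arg_min_def not_less)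
    then have "inner E X + \<sigma> / 2 * (norm E)\<^sup>2 \<le> - (t * inner b d)
        + inner (E + t *\<^sub>R adjoint \<A> d) X + \<sigma> / 2 * (norm (E + t *\<^sub>R adjoint \<A> d))\<^sup>2"
      unfolding aug_lagrangian_psd[OF Z] Et E_def[symmetric] by (simp add: inner_add_right)
    then show "0 \<le> t * inner (\<A> (X + \<sigma> *\<^sub>R E) - b) d + t\<^sup>2 * (\<sigma> / 2 * (norm (adjoint \<A> d))\<^sup>2)"
      unfolding power2_norm_add_scaleR
      by (simp add: inner_add_left inner_diff_left inner_commute[of "adjoint \<A> d"] adj
          linear_add[OF lin] linear_scale[OF lin] algebra_simps)
  qed
  define g where "g = \<A> (X + \<sigma> *\<^sub>R E) - b"
  have "inner g g \<le> 0"
    using slope[of "- g", folded g_def] by simp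
  then have "g = 0"
    by (metis inner_ge_zero inner_eq_zero_iff order_antisym)
  then show ?thesis by (simp add: g_def E_def)
qed

section \<open>The identity for the iterates\<close>

theorem theorem1:
  fixes \<phi> :: "('n::finite) symmat \<Rightarrow> 'n symmat"
    and \<A> :: "'n symmat \<Rightarrow> real^'m"
    and C :: "'n symmat" and b :: "real^'m" and \<sigma> :: real
    and W Z X U :: "nat \<Rightarrow> 'n symmat" and y :: "nat \<Rightarrow> real^'m"
    and K :: "'n symmat set" and h :: "'n symmat \<Rightarrow> real"
    and \<T> :: "'n symmat \<Rightarrow> 'n symmat"
  assumes phi_linear: "linear \<phi>"
    and phi_selfadjoint: "\<And>P Q. inner (\<phi> P) Q = inner P (\<phi> Q)"
    and phi_psd: "\<And>P. 0 \<le> inner P (\<phi> P)"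
    and A_linear: "linear \<A>"
    and A_surj: "surj \<A>"
    and slater: "\<exists>X'. pos_def X' \<and> \<A> X' = b"
    and sigma_pos: "\<sigma> > 0"
    and admm: "modified_admm \<phi> \<A> C b \<sigma> W y Z X"
    and U_def: "\<And>k. U k = X k - \<sigma> *\<^sub>R (\<phi> (X k) + C - adjoint \<A> (y (Suc k)))"
    and K_def: "K = {P. \<A> P = b}"
    and h_def: "\<And>P. h P = 1/2 * inner P (\<phi> P) + inner C P"
    and T_def: "\<And>V. \<T> V = V - resolvent \<sigma> (normal_cone psd_cone) V
          + resolvent \<sigma> (normal_cone K)
              (2 *\<^sub>R resolvent \<sigma> (normal_cone psd_cone) V - V
               - \<sigma> *\<^sub>R gradient h (resolvent \<sigma> (normal_cone psd_cone) V))"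
  shows "\<And>k. U (Suc k) = \<T> (U k)"
proof -
  fix k
  note step = admm[unfolded modified_admm_def, THEN conjunct2, rule_format]
  have W: "W (Suc i) = X i" for i using step by blast
  have Z_mem: "Z i \<in> psd_cone" for i
  proof (cases i)
    case 0
    then show ?thesis using admm by (simp add: modified_admm_def)
  next
    case (Suc j)
    then show ?thesis using step[of j] argmin_psd_in_cone by blast
  qed
  define X' where "X' = X (Suc k)"
  define Z' where "Z' = Z (Suc k)"
  have X'_step: "X' = X k + \<sigma> *\<^sub>R (- \<phi> (W (Suc k)) + adjoint \<A> (y (Suc k)) + Z' - C)"
    using step[of k] by (simp add: X'_def Z'_def W algebra_simps)
  \<comment> \<open>Since \<open>W (Suc k) = X k\<close>, the multiplier update and
    \<open>U k\<close> evaluate \<open>\<phi>\<close> at the same point and differ only by the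
    \<open>Z'\<close> term.\<close>
  have X'_U: "X' = U k + \<sigma> *\<^sub>R Z'"
    unfolding X'_step U_def W by (simp add: algebra_simps)
  then have U_eq: "U k = X' - \<sigma> *\<^sub>R Z'" by simp
  have Z': "Z' \<in> psd_cone" by (simp add: Z'_def Z_mem)

  have var: "0 \<le> inner X' (Q - Z')" if "Q \<in> psd_cone" for Q
    unfolding X'_step Z'_def using step[of k] that argmin_psd_variational by blast
  \<comment> \<open>Testing with 0 gives this bound; testing with \<open>Z' + Q\<close> gives
    nonnegativity on the cone, and at \<open>Q = Z'\<close> the two yield complementarity.\<close>
  have "inner X' Z' \<le> 0"
    using var[OF zero_in_psd_cone] by simp
  moreover have dual: "0 \<le> inner X' Q" if "Q \<in> psd_cone" for Q
    using var[of "Z' + Q"] psd_cone_add[OF Z' that] by simp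
  ultimately have compl: "inner X' Z' = 0"
    using Z' by (simp add: order_antisym)
  have X'_mem: "X' \<in> psd_cone" using dual psd_cone_iff_dual by blast
  have proj_psd: "resolvent \<sigma> (normal_cone psd_cone) (U k) = X'"
  proof (rule resolvent_normal_cone_eqI[OF sigma_pos X'_mem])
    fix Q :: "'n symmat" assume "Q \<in> psd_cone"
    then have "0 \<le> \<sigma> * inner Z' Q"
      using sigma_pos inner_psd_cone_nonneg[OF Z'] by simp
    then show "inner (U k - X') (Q - X') \<le> 0"
      using compl X'_U by (simp add: inner_diff_right inner_commute)
  qed

  \<comment> \<open>The next \<open>y\<close>-step still sees the old \<open>Z'\<close>, so its
    stationarity concerns \<open>p\<close> and not the next \<open>X\<close>. The point
    \<open>q\<close> is the argument of the second resolvent.\<close>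
  define p where "p = X' + \<sigma> *\<^sub>R (- \<phi> X' + adjoint \<A> (y (Suc (Suc k))) + Z' - C)"
  define q where "q = 2 *\<^sub>R X' - U k - \<sigma> *\<^sub>R (\<phi> X' + C)"
  have p_q: "p = q + \<sigma> *\<^sub>R adjoint \<A> (y (Suc (Suc k)))"
    unfolding p_def q_def by (simp add: U_eq algebra_simps scaleR_2)
  have "is_arg_min (\<lambda>y'. aug_lagrangian \<phi> \<A> C b \<sigma> X' y' Z' X') (\<lambda>_. True) (y (Suc (Suc k)))"
    using step[of "Suc k"] by (simp add: X'_def Z'_def W)
  then have "\<A> p = b"
    unfolding p_def using Z' A_linear by (rule argmin_multiplier_stationary)
  moreover have "inner (q - p) (r - p) \<le> 0" if "\<A> r = b" for r
    using that \<open>\<A> p = b\<close> adjoint_works[OF A_linear, of "r - p" "y (Suc (Suc k))"]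
    by (simp add: p_q inner_commute linear_diff[OF A_linear])
  ultimately have proj_K: "resolvent \<sigma> (normal_cone K) q = p"
    using sigma_pos by (intro resolvent_normal_cone_eqI) (auto simp: K_def)

  have "h = (\<lambda>P. 1/2 * inner P (\<phi> P) + inner C P)" using h_def by blast
  then have grad: "gradient h X' = \<phi> X' + C"
    using gradient_quadratic[OF phi_linear phi_selfadjoint] by simp
  have "\<T> (U k) = U k - X' + p"
    unfolding T_def proj_psd grad q_def[symmetric] proj_K ..
  \<comment> \<open>The difference \<open>U k - X'\<close> is
    \<open>- (\<sigma> *\<^sub>R Z')\<close> and cancels the \<open>Z'\<close> term in
    \<open>p\<close>.\<close>
  also have "\<dots> = X' - \<sigma> *\<^sub>R (\<phi> X' + C - adjoint \<A> (y (Suc (Suc k))))"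
    unfolding p_def by (simp add: U_eq algebra_simps)
  finally show "U (Suc k) = \<T> (U k)"
    by (simp add: U_def[of "Suc k"] X'_def)
qed

end
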